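(* Let $\mathscr{H}$ be a complex Hilbert space and let $T\in\mathbb{B}(\mathscr{H})$. Then the following inequalities hold: (i) $$\sqrt{\frac14\|T^*T+TT^*\|+ \alpha} \leq w(T) \leq \sqrt{\frac14\|T^*T+TT^*\|+ \beta},$$ where $\alpha = \frac12 \big| \|Re(T)\|^2-\|Im(T)\|^2\big|$ and $\beta = \frac12 \left( \|Re(T)\|^2+\|Im(T)\|^2\right)$; (ii) $$\sqrt{\frac14\|T^*T+TT^*\|+ \gamma} \leq w(T) \leq \sqrt{\frac14\|T^*T+TT^*\|+ \delta},$$ where $\gamma=\frac{1}{4}\left| \|Re(T)+Im(T)\|^2-\|Re(T)-Im(T)\|^2\right|$ and $\delta=\frac{1}{4} \left(\|Re(T)+Im(T)\|^2+\|Re(T)-Im(T)\|^2\right)$.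
   Context: $\mathbb{B}(\mathscr{H})$ denotes the bounded linear operators on $\mathscr{H}$, $\|\cdot\|$ the operator norm. $Re(T)=\frac12(T+T^* )$ and $Im(T)=\frac1{2i}(T-T^* )$. The numerical radius is $w(T)=\sup\{|\langle Tx,x\rangle| : x\in\mathscr{H},\ \|x\|=1\}$. *)

theory Defs
  imports "HOL-Analysis.Analysis"
begin

text \<open>
  Complex Hilbert spaces, as Banach spaces whose real scalar multiplication and norm are
  those induced by a complex scalar multiplication and a complex inner product. The inner
  product is linear in the first argument. The zero space is not excluded.
\<close>

class complex_hilbert_space = banach +
  fixes scaleC :: "complex \<Rightarrow> 'a \<Rightarrow> 'a" (infixr "*\<^sub>C" 75)
    and cinner :: "'a \<Rightarrow> 'a \<Rightarrow> complex"
  assumes scaleC_add_right: "a *\<^sub>C (x + y) = a *\<^sub>C x + a *\<^sub>C y"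
    and scaleC_add_left: "(a + b) *\<^sub>C x = a *\<^sub>C x + b *\<^sub>C x"
    and scaleC_scaleC: "a *\<^sub>C (b *\<^sub>C x) = (a * b) *\<^sub>C x"
    and scaleC_one: "1 *\<^sub>C x = x"
    and scaleR_eq_scaleC: "r *\<^sub>R x = complex_of_real r *\<^sub>C x"
    and cinner_commute: "cinner x y = cnj (cinner y x)"
    and cinner_add_left: "cinner (x + y) z = cinner x z + cinner y z"
    and cinner_scaleC_left: "cinner (a *\<^sub>C x) y = a * cinner x y"
    and cinner_self_nonneg: "0 \<le> Re (cinner x x)"
    and cinner_self_eq_zero_iff: "cinner x x = 0 \<longleftrightarrow> x = 0"
    and norm_eq_sqrt_cinner: "norm x = sqrt (Re (cinner x x))"

instantiation complex :: complex_hilbert_space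
begin

definition scaleC_complex :: "complex \<Rightarrow> complex \<Rightarrow> complex"
  where "scaleC_complex a x = a * x"

definition cinner_complex :: "complex \<Rightarrow> complex \<Rightarrow> complex"
  where "cinner_complex x y = x * cnj y"

instance
  by standard
    (auto simp: scaleC_complex_def cinner_complex_def algebra_simps scaleR_conv_of_real
      norm_complex_def power2_eq_square)

end

definition bounded_clinear ::
    "('a::complex_hilbert_space \<Rightarrow> 'b::complex_hilbert_space) \<Rightarrow> bool"
  where "bounded_clinear T \<longleftrightarrow> bounded_linear T \<and> (\<forall>c x. T (c *\<^sub>C x) = c *\<^sub>C T x)"

text \<open>
  As for the library's \<^const>\<open>adjoint\<close>, the value is meaningful only if an adjoint exists;
  for bounded complex-linear operators it exists and is unique by the Riesz representation
  theorem.
\<close>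

definition cadjoint :: "('a::complex_hilbert_space \<Rightarrow> 'a) \<Rightarrow> 'a \<Rightarrow> 'a"
  where "cadjoint T = (SOME S. \<forall>x y. cinner (T x) y = cinner x (S y))"

definition re_op :: "('a::complex_hilbert_space \<Rightarrow> 'a) \<Rightarrow> 'a \<Rightarrow> 'a"
  where "re_op T = (\<lambda>x. (1 / 2) *\<^sub>C (T x + cadjoint T x))"

definition im_op :: "('a::complex_hilbert_space \<Rightarrow> 'a) \<Rightarrow> 'a \<Rightarrow> 'a"
  where "im_op T = (\<lambda>x. (1 / (2 * \<i>)) *\<^sub>C (T x - cadjoint T x))"

text \<open>
  The supremum is taken in the nonnegative reals: inserting 0 only matters for the zero
  space, where there are no unit vectors and \<^term>\<open>Sup {} :: real\<close> is unspecified.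
\<close>

definition numerical_radius :: "('a::complex_hilbert_space \<Rightarrow> 'a) \<Rightarrow> real"
  where "numerical_radius T = Sup (insert 0 {cmod (cinner (T x) x) |x. norm x = 1})"

end

(*
  Write T = A + \<i>B with A = Re T and B = Im T self-adjoint, so that T*T + TT* = 2(A^2 + B^2) and
  |<Tx,x>|^2 = <Ax,x>^2 + <Bx,x>^2. Since the norm of a self-adjoint operator is the supremum of its
  quadratic form, \<parallel>A\<parallel> and \<parallel>B\<parallel> are at most w(T), while \<parallel>A + B\<parallel> and \<parallel>A - B\<parallel> are at most
  sqrt 2 w(T). The lower bounds follow from \<parallel>A^2 + B^2\<parallel> \<le> \<parallel>A\<parallel>^2 + \<parallel>B\<parallel>^2 and max(s,t) = (s + t + |s - t|)/2.
  For the upper bounds, average w(T)^2 \<le> \<parallel>A^2 + B^2\<parallel> and w(T)^2 \<le> \<parallel>A\<parallel>^2 + \<parallel>B\<parallel>^2.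
  Part (ii) is the same argument for the pair ((A + B)/sqrt 2, (A - B)/sqrt 2).
*)

theory Submission
  imports Defs
begin

subsection \<open>Complex inner product spaces\<close>

text \<open>The real part is a real inner product with the same norm, and it determines
  \<open>cinner\<close>: the imaginary part of \<open>cinner x y\<close> is
  \<open>- rinner (\<i> *\<^sub>C x) y\<close>.\<close>

definition rinner :: "'a::complex_hilbert_space \<Rightarrow> 'a \<Rightarrow> real"
  where "rinner x y = Re (cinner x y)"

lemma rinner_commute: "rinner x y = rinner y x"
  unfolding rinner_def by (subst cinner_commute) simp

lemma rinner_add_left: "rinner (x + y) z = rinner x z + rinner y z"
  by (simp add: rinner_def cinner_add_left)

lemma rinner_scaleR_left: "rinner (r *\<^sub>R x) y = r * rinner x y"
  by (simp add: rinner_def scaleR_eq_scaleC cinner_scaleC_left)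

lemma rinner_minus_left: "rinner (- x) y = - rinner x y"
  using rinner_scaleR_left[of "-1" x y] by simp

lemma rinner_diff_left: "rinner (x - y) z = rinner x z - rinner y z"
  using rinner_add_left[of x "- y" z] by (simp add: rinner_minus_left)

lemma rinner_add_right: "rinner z (x + y) = rinner z x + rinner z y"
  by (metis rinner_add_left rinner_commute)

lemma rinner_diff_right: "rinner z (x - y) = rinner z x - rinner z y"
  by (metis rinner_diff_left rinner_commute)

lemma rinner_scaleR_right: "rinner x (r *\<^sub>R y) = r * rinner x y"
  by (metis rinner_scaleR_left rinner_commute)

lemmas rinner_simps =
  rinner_add_left rinner_add_right rinner_diff_left rinner_diff_right
  rinner_scaleR_left rinner_scaleR_right

lemma rinner_self: "rinner x x = (norm x)\<^sup>2"
  by (simp add: rinner_def norm_eq_sqrt_cinner cinner_self_nonneg)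

lemma norm_add_sq: "(norm (x + y))\<^sup>2 = (norm x)\<^sup>2 + 2 * rinner x y + (norm y)\<^sup>2"
  for x y :: "'a::complex_hilbert_space"
  by (simp add: rinner_self[symmetric] rinner_simps rinner_commute[of y x])

lemma norm_diff_sq: "(norm (x - y))\<^sup>2 = (norm x)\<^sup>2 - 2 * rinner x y + (norm y)\<^sup>2"
  for x y :: "'a::complex_hilbert_space"
  by (simp add: rinner_self[symmetric] rinner_simps rinner_commute[of y x])

lemma parallelogram_law:
  "(norm (x + y))\<^sup>2 + (norm (x - y))\<^sup>2 = 2 * (norm x)\<^sup>2 + 2 * (norm y)\<^sup>2"
  for x y :: "'a::complex_hilbert_space"
  by (simp add: norm_add_sq norm_diff_sq)

text \<open>Cauchy-Schwarz falls out of the triangle inequality, which the Banach space class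
  already supplies, by squaring it and cancelling.\<close>

lemma rinner_le_norm: "rinner x y \<le> norm x * norm y"
proof -
  have "(norm x)\<^sup>2 + 2 * rinner x y + (norm y)\<^sup>2 \<le> (norm x + norm y)\<^sup>2"
    unfolding norm_add_sq[symmetric] by (intro power_mono norm_triangle_ineq) simp
  then show ?thesis by (simp add: power2_sum)
qed

lemma cinner_scaleC_right: "cinner x (a *\<^sub>C y) = cnj a * cinner x y"
  by (metis cinner_commute cinner_scaleC_left complex_cnj_mult)

lemma cinner_minus_left: "cinner (- x) y = - cinner x y"
  using cinner_scaleC_left[of "-1" x y] scaleR_eq_scaleC[of "-1" x] by simp

lemma cinner_diff_left: "cinner (x - y) z = cinner x z - cinner y z"
  using cinner_add_left[of x "- y" z] by (simp add: cinner_minus_left)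

lemma norm_scaleC: "norm (a *\<^sub>C x) = cmod a * norm x"
proof -
  have "cinner (a *\<^sub>C x) (a *\<^sub>C x) = (a * cnj a) * cinner x x"
    by (simp add: cinner_scaleC_left cinner_scaleC_right)
  then have "(norm (a *\<^sub>C x))\<^sup>2 = (cmod a * norm x)\<^sup>2"
    by (simp add: rinner_self[of x, symmetric] rinner_self[of "a *\<^sub>C x", symmetric] rinner_def
        power_mult_distrib complex_norm_square[symmetric] flip: of_real_power)
  then show ?thesis by simp
qed

lemma bounded_linear_scaleC: "bounded_linear (\<lambda>x::'a::complex_hilbert_space. a *\<^sub>C x)"
  by (rule bounded_linear_intro[where K = "cmod a"])
    (simp_all add: scaleC_add_right scaleR_eq_scaleC scaleC_scaleC mult.commute norm_scaleC)

text \<open>Rotating \<open>x\<close> by a unimodular scalar makes the inner product real.\<close>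

lemma cmod_cinner_le: "cmod (cinner x y) \<le> norm x * norm y"
proof (cases "cinner x y = 0")
  case False
  define c where "c = cnj (sgn (cinner x y))"
  have "cmod c = 1" using False by (simp add: c_def norm_sgn)
  have "c * cinner x y = of_real (cmod (cinner x y))"
    using False complex_norm_square[of "cinner x y"]
    by (simp add: c_def sgn_eq power2_eq_square field_simps)
  then have "cmod (cinner x y) = rinner (c *\<^sub>C x) y"
    by (simp add: rinner_def cinner_scaleC_left)
  also have "\<dots> \<le> norm x * norm y"
    using rinner_le_norm[of "c *\<^sub>C x" y] \<open>cmod c = 1\<close> by (simp add: norm_scaleC)
  finally show ?thesis .
qed simp

lemma abs_rinner_le: "\<bar>rinner x y\<bar> \<le> norm x * norm y"
  unfolding rinner_def by (rule order_trans[OF abs_Re_le_cmod cmod_cinner_le])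

lemma rinner_eqI:
  assumes "\<And>z. rinner z x = rinner z y"
  shows "x = y"
proof -
  have "(norm (x - y))\<^sup>2 = 0"
    using assms[of "x - y"] by (simp add: rinner_self[symmetric] rinner_diff_right)
  then show ?thesis by simp
qed

subsection \<open>Riesz representation and adjoints\<close>

text \<open>
  The representing vector minimises \<open>x \<mapsto> \<parallel>x\<parallel>\<^sup>2 - 2 f x\<close>; by the parallelogram law every
  minimising sequence is Cauchy.
\<close>

lemma real_riesz:
  fixes f :: "'a::complex_hilbert_space \<Rightarrow> real"
  assumes f: "bounded_linear f"
  shows "\<exists>y. \<forall>x. f x = rinner x y"
proof -
  interpret f: bounded_linear f by (rule f)
  define J where "J x = (norm x)\<^sup>2 - 2 * f x" for x
  \<comment> \<open>Completing the square in \<open>norm x\<close> gives the lower bound.\<close>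
  have J_below: "- (onorm f)\<^sup>2 \<le> J x" for x
  proof -
    have "f x \<le> onorm f * norm x" using onorm[OF f, of x] by simp
    moreover have "0 \<le> (norm x - onorm f)\<^sup>2" by simp
    ultimately show ?thesis by (simp add: J_def power2_diff algebra_simps)
  qed
  define m where "m = Inf (range J)"
  have bdd: "bdd_below (range J)" using J_below by (rule bdd_belowI2)
  have m_le: "m \<le> J x" for x unfolding m_def by (intro cInf_lower bdd) simp
  have "\<exists>x. J x < m + inverse (Suc n)" for n
    using cInf_lessD[of "range J" "m + inverse (Suc n)"] by (auto simp: m_def)
  then obtain X where X: "\<And>n. J (X n) < m + inverse (Suc n)" by metis
  \<comment> \<open>The midpoint of \<open>x\<close> and \<open>y\<close> cannot have a value below
    \<open>m\<close>, so two almost minimal points are close.\<close>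
  have par: "(norm (x - y))\<^sup>2 \<le> 2 * (J x - m) + 2 * (J y - m)" for x y
  proof -
    have "J ((1/2) *\<^sub>R (x + y)) = (norm (x + y))\<^sup>2 / 4 - (f x + f y)"
      by (simp only: J_def f.scaleR f.add norm_scaleR power_mult_distrib)
        (simp add: power2_eq_square field_simps)
    then have "4 * m \<le> (norm (x + y))\<^sup>2 - 4 * (f x + f y)"
      using m_le[of "(1/2) *\<^sub>R (x + y)"] by simp
    then show ?thesis using parallelogram_law[of x y] by (simp add: J_def)
  qed
  have "Cauchy X"
  proof (rule metric_CauchyI)
    fix e :: real assume "0 < e"
    then obtain N where N: "inverse (Suc N) < e\<^sup>2 / 4"
      using reals_Archimedean[of "e\<^sup>2 / 4"] by auto
    have small: "J (X k) - m < e\<^sup>2 / 4" if "N \<le> k" for k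
    proof -
      have "inverse (real (Suc k)) \<le> inverse (Suc N)" using that by (intro le_imp_inverse_le) auto
      then show ?thesis using X[of k] N by linarith
    qed
    show "\<exists>M. \<forall>i\<ge>M. \<forall>j\<ge>M. dist (X i) (X j) < e"
    proof (intro exI allI impI)
      fix i j assume "N \<le> i" "N \<le> j"
      then have "(norm (X i - X j))\<^sup>2 < e\<^sup>2" using par[of "X i" "X j"] small[of i] small[of j] by simp
      then show "dist (X i) (X j) < e"
        using \<open>0 < e\<close> by (simp add: dist_norm power_less_imp_less_base)
    qed
  qed
  then obtain y where y: "X \<longlonglongrightarrow> y" using Cauchy_convergent_iff convergent_def by blast
  have "(\<lambda>n. J (X n)) \<longlonglongrightarrow> J y"
    unfolding J_def by (intro tendsto_intros f.tendsto y)
  moreover have "(\<lambda>n. m + inverse (Suc n)) \<longlonglongrightarrow> m + 0"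
    by (intro tendsto_intros LIMSEQ_inverse_real_of_nat)
  ultimately have "J y \<le> m + 0"
    by (rule LIMSEQ_le) (use X in \<open>auto intro: less_imp_le\<close>)
  then have min: "J y \<le> J x" for x using m_le[of x] by simp
  have "f x = rinner x y" for x
  proof (cases "x = 0")
    case True
    then show ?thesis using rinner_scaleR_left[of 0 x y] f.zero by simp
  next
    case False
    define d where "d = rinner x y - f x"
    \<comment> \<open>This quadratic in \<open>t\<close> is
      \<open>J (y + t *\<^sub>R x) - J y\<close>. Its minimum, at
      \<open>t = - d / (norm x)\<^sup>2\<close>, is negative unless \<open>d = 0\<close>.\<close>
    have pos: "0 \<le> 2 * t * d + t\<^sup>2 * (norm x)\<^sup>2" for t
      using min[of "y + t *\<^sub>R x"]
      by (simp add: J_def d_def norm_add_sq f.add f.scaleR rinner_scaleR_right power_mult_distrib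
          rinner_commute[of y x] algebra_simps)
    have "0 \<le> - (d\<^sup>2 / (norm x)\<^sup>2)"
      using pos[of "- d / (norm x)\<^sup>2"] False by (simp add: power2_eq_square field_simps)
    then have "d = 0" using False by (simp add: field_simps)
    then show ?thesis by (simp add: d_def)
  qed
  then show ?thesis by blast
qed

lemma cadjoint_exists:
  assumes T: "bounded_clinear T"
  shows "\<exists>S. \<forall>x y. cinner (T x) y = cinner x (S y)"
proof -
  have lin: "bounded_linear T" and C: "T (c *\<^sub>C x) = c *\<^sub>C T x" for c x
    using T by (auto simp: bounded_clinear_def)
  have "\<exists>z. \<forall>x. cinner (T x) y = cinner x z" for y
  proof -
    have "bounded_linear (\<lambda>x. rinner x y)"
      by (rule bounded_linear_intro[where K = "norm y"])
        (simp_all add: rinner_simps abs_rinner_le)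
    then have "bounded_linear (\<lambda>x. rinner (T x) y)"
      using bounded_linear_compose lin by blast
    then obtain z where z: "\<And>x. rinner (T x) y = rinner x z" using real_riesz by blast
    \<comment> \<open>Riesz only matches real parts; complex linearity of \<open>T\<close>, used at
      \<open>\<i> *\<^sub>C x\<close>, matches the imaginary parts.\<close>
    have "cinner (T x) y = cinner x z" for x
      using z[of x] z[of "\<i> *\<^sub>C x"]
      by (simp add: rinner_def C cinner_scaleC_left complex_eq_iff)
    then show ?thesis by blast
  qed
  then show ?thesis by metis
qed

lemma cinner_cadjoint:
  assumes "bounded_clinear T"
  shows "cinner (T x) y = cinner x (cadjoint T y)"
  using someI_ex[OF cadjoint_exists[OF assms]] unfolding cadjoint_def by blast

lemma rinner_cadjoint:
  assumes "bounded_clinear T"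
  shows "rinner (T x) y = rinner x (cadjoint T y)"
  using cinner_cadjoint[OF assms] by (simp add: rinner_def)

lemma cinner_cadjoint_left:
  assumes "bounded_clinear T"
  shows "cinner (cadjoint T x) y = cnj (cinner (T y) x)"
  unfolding cinner_cadjoint[OF assms] by (rule cinner_commute)

text \<open>Linearity is tested against all vectors. For the bound, test the adjoint relation at
  \<open>cadjoint T x\<close> itself and cancel one factor of its norm.\<close>

lemma bounded_linear_cadjoint:
  assumes T: "bounded_clinear T"
  shows "bounded_linear (cadjoint T)"
proof (rule bounded_linear_intro)
  have lin: "bounded_linear T" using T by (simp add: bounded_clinear_def)
  show "cadjoint T (x + y) = cadjoint T x + cadjoint T y" for x y
    by (rule rinner_eqI) (simp add: rinner_cadjoint[OF T, symmetric] rinner_simps)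
  show "cadjoint T (r *\<^sub>R x) = r *\<^sub>R cadjoint T x" for r x
    by (rule rinner_eqI) (simp add: rinner_cadjoint[OF T, symmetric] rinner_simps)
  show "norm (cadjoint T x) \<le> norm x * onorm T" for x
  proof (cases "cadjoint T x = 0")
    case False
    let ?z = "cadjoint T x"
    have "norm ?z * norm ?z = rinner (T ?z) x"
      by (simp add: rinner_cadjoint[OF T] rinner_self power2_eq_square)
    also have "\<dots> \<le> norm (T ?z) * norm x" by (rule rinner_le_norm)
    also have "\<dots> \<le> (onorm T * norm ?z) * norm x" by (intro mult_right_mono onorm lin) simp
    also have "\<dots> = norm ?z * (norm x * onorm T)" by simp
    finally show ?thesis using False by simp
  qed (simp add: onorm_pos_le[OF lin])
qed

subsection \<open>Norms of symmetric operators\<close>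

text \<open>Polarisation with \<open>x\<close> and the multiple of \<open>A x\<close> that has the norm of \<open>x\<close>.\<close>

lemma onorm_symmetric_le:
  fixes A :: "'a::complex_hilbert_space \<Rightarrow> 'a"
  assumes A: "bounded_linear A"
    and sym: "\<And>x y. rinner (A x) y = rinner (A y) x"
    and M: "\<And>x. \<bar>rinner (A x) x\<bar> \<le> M * (norm x)\<^sup>2"
    and "0 \<le> M"
  shows "onorm A \<le> M"
proof (rule onorm_bound)
  interpret A: bounded_linear A by (rule A)
  fix x
  have bound: "2 * rinner (A x) y \<le> M * ((norm x)\<^sup>2 + (norm y)\<^sup>2)" for y
  proof -
    \<comment> \<open>Symmetry merges the two cross terms of the polarisation identity.\<close>
    have "4 * rinner (A x) y = rinner (A (x + y)) (x + y) - rinner (A (x - y)) (x - y)"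
      by (simp add: A.add A.diff rinner_simps sym[of y x])
    also have "\<dots> \<le> M * (norm (x + y))\<^sup>2 + M * (norm (x - y))\<^sup>2"
      using M[of "x + y"] M[of "x - y"] by linarith
    also have "\<dots> = 2 * (M * ((norm x)\<^sup>2 + (norm y)\<^sup>2))"
      unfolding distrib_left[symmetric] parallelogram_law by simp
    finally show ?thesis by simp
  qed
  show "norm (A x) \<le> M * norm x"
  proof (cases "A x = 0 \<or> x = 0")
    case True
    then show ?thesis using \<open>0 \<le> M\<close> A.zero by auto
  next
    case False
    define t where "t = norm x / norm (A x)"
    have "2 * (t * (norm (A x))\<^sup>2) \<le> M * ((norm x)\<^sup>2 + (t * norm (A x))\<^sup>2)"
      using bound[of "t *\<^sub>R A x"] by (simp add: rinner_scaleR_right rinner_self power_mult_distrib)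
    moreover have "t * norm (A x) = norm x" using False by (simp add: t_def)
    moreover have "t * (norm (A x))\<^sup>2 = norm x * norm (A x)"
      using False by (simp add: t_def power2_eq_square)
    ultimately have "norm x * norm (A x) \<le> norm x * (M * norm x)"
      by (simp add: power2_eq_square[of "norm x"] mult_ac)
    then show ?thesis using False by simp
  qed
qed fact

lemma rinner_apply_sq_le:
  assumes "bounded_linear A"
  shows "(rinner (A x) x)\<^sup>2 \<le> (onorm A)\<^sup>2 * (norm x)^4"
proof -
  have "\<bar>rinner (A x) x\<bar> \<le> norm (A x) * norm x"
    by (rule abs_rinner_le)
  also have "\<dots> \<le> (onorm A * norm x) * norm x" by (intro mult_right_mono onorm assms) simp
  finally have "\<bar>rinner (A x) x\<bar>\<^sup>2 \<le> (onorm A * norm x * norm x)\<^sup>2"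
    by (rule power_mono) simp
  then show ?thesis by (simp add: power_mult_distrib power4_eq_xxxx power2_eq_square mult_ac)
qed

lemma norm_apply_sq_le:
  assumes "bounded_linear A"
  shows "(norm (A x))\<^sup>2 \<le> (onorm A)\<^sup>2 * (norm x)\<^sup>2"
  using power_mono[OF onorm[OF assms, of x], of 2] by (simp add: power_mult_distrib)

subsection \<open>The numerical radius\<close>

lemma bdd_above_numerical_range:
  assumes "bounded_linear T"
  shows "bdd_above (insert 0 {cmod (cinner (T x) x) |x. norm x = 1})"
proof (rule bdd_aboveI[where M = "onorm T"])
  fix r assume "r \<in> insert 0 {cmod (cinner (T x) x) |x. norm x = 1}"
  then consider "r = 0" | x where "norm x = 1" "r = cmod (cinner (T x) x)" by blast
  then show "r \<le> onorm T"
  proof cases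
    case (2 x)
    then show ?thesis using cmod_cinner_le[of "T x" x] onorm[OF assms, of x] by simp
  qed (use onorm_pos_le[OF assms] in simp)
qed

lemma numerical_radius_nonneg:
  assumes "bounded_linear T"
  shows "0 \<le> numerical_radius T"
  unfolding numerical_radius_def
  by (intro cSup_upper bdd_above_numerical_range assms) simp

lemma cmod_cinner_le_numerical_radius:
  assumes T: "bounded_linear T"
  shows "cmod (cinner (T x) x) \<le> numerical_radius T * (norm x)\<^sup>2"
proof (cases "x = 0")
  case True
  then show ?thesis using cmod_cinner_le[of "T x" x] by simp
next
  case False
  interpret T: bounded_linear T by (rule T)
  define u where "u = (1 / norm x) *\<^sub>R x"
  have u: "norm u = 1" "x = norm x *\<^sub>R u" using False by (simp_all add: u_def)
  have "cinner (T (r *\<^sub>R u)) (r *\<^sub>R u) = of_real (r\<^sup>2) * cinner (T u) u" for r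
    unfolding T.scaleR
    by (simp add: scaleR_eq_scaleC cinner_scaleC_left cinner_scaleC_right power2_eq_square)
  then have "cinner (T x) x = of_real ((norm x)\<^sup>2) * cinner (T u) u"
    using u(2) by metis
  then have "cmod (cinner (T x) x) = (norm x)\<^sup>2 * cmod (cinner (T u) u)"
    by (simp add: norm_mult norm_power)
  moreover have "cmod (cinner (T u) u) \<le> numerical_radius T"
    unfolding numerical_radius_def
    by (intro cSup_upper bdd_above_numerical_range T) (use u(1) in blast)
  ultimately show ?thesis by (simp add: mult.commute mult_right_mono)
qed

text \<open>The bound \<open>0 \<le> c\<close> covers the inserted 0, which is the whole set on the
  zero space.\<close>

lemma numerical_radius_le_sqrt:
  assumes "0 \<le> c" "\<And>x. norm x = 1 \<Longrightarrow> (cmod (cinner (T x) x))\<^sup>2 \<le> c"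
  shows "numerical_radius T \<le> sqrt c"
  unfolding numerical_radius_def
  by (rule cSup_least) (use assms real_le_rsqrt in auto)

subsection \<open>Cartesian decomposition\<close>

lemma bounded_linear_re_op:
  assumes "bounded_clinear T"
  shows "bounded_linear (re_op T)"
  unfolding re_op_def
  using assms bounded_linear_cadjoint[OF assms]
  by (intro bounded_linear_compose[OF bounded_linear_scaleC] bounded_linear_add)
    (simp_all add: bounded_clinear_def)

lemma bounded_linear_im_op:
  assumes "bounded_clinear T"
  shows "bounded_linear (im_op T)"
  unfolding im_op_def
  using assms bounded_linear_cadjoint[OF assms]
  by (intro bounded_linear_compose[OF bounded_linear_scaleC] bounded_linear_sub)
    (simp_all add: bounded_clinear_def)

text \<open>The right side is visibly symmetric in \<open>x\<close> and \<open>y\<close>, which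
  gives self-adjointness, and at \<open>y = x\<close> it is the real part of
  \<open>cinner (T x) x\<close>. The next lemma is the analogue for imaginary parts.\<close>

lemma rinner_re_op:
  assumes "bounded_clinear T"
  shows "rinner (re_op T x) y = (Re (cinner (T x) y) + Re (cinner (T y) x)) / 2"
  by (simp add: re_op_def rinner_def cinner_scaleC_left cinner_add_left
      cinner_cadjoint_left[OF assms])

lemma rinner_im_op:
  assumes "bounded_clinear T"
  shows "rinner (im_op T x) y = (Im (cinner (T x) y) + Im (cinner (T y) x)) / 2"
proof -
  have i: "Re (1 / (2 * \<i>) * z) = Im z / 2" for z
    by (simp add: Re_divide power2_eq_square)
  show ?thesis
    unfolding im_op_def rinner_def cinner_scaleC_left i
    \<comment> \<open>The adjoint contributes a subtracted conjugate, whose imaginary part enters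
      with a plus sign.\<close>
    by (simp add: cinner_diff_left cinner_cadjoint_left[OF assms])
qed

text \<open>The parallelogram law for \<open>T x\<close> and \<open>cadjoint T x\<close>. It serves
  as T*T + TT* = 2(A^2 + B^2) at the level of quadratic forms, so no operators are squared.\<close>

lemma norm_re_op_im_op:
  "(norm (re_op T x))\<^sup>2 + (norm (im_op T x))\<^sup>2 = ((norm (T x))\<^sup>2 + (norm (cadjoint T x))\<^sup>2) / 2"
  using parallelogram_law[of "T x" "cadjoint T x"]
  by (simp add: re_op_def im_op_def norm_scaleC norm_divide norm_mult power_divide)

theorem theorem2p10:
  fixes T :: "'a::complex_hilbert_space \<Rightarrow> 'a"
    and \<alpha> \<beta> \<gamma> \<delta> :: real
  assumes T: "bounded_clinear T"
    and \<alpha>: "\<alpha> = 1 / 2 * \<bar>(onorm (re_op T))\<^sup>2 - (onorm (im_op T))\<^sup>2\<bar>"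
    and \<beta>: "\<beta> = 1 / 2 * ((onorm (re_op T))\<^sup>2 + (onorm (im_op T))\<^sup>2)"
    and \<gamma>: "\<gamma> = 1 / 4 * \<bar>(onorm (\<lambda>x. re_op T x + im_op T x))\<^sup>2
                          - (onorm (\<lambda>x. re_op T x - im_op T x))\<^sup>2\<bar>"
    and \<delta>: "\<delta> = 1 / 4 * ((onorm (\<lambda>x. re_op T x + im_op T x))\<^sup>2
                          + (onorm (\<lambda>x. re_op T x - im_op T x))\<^sup>2)"
  shows "(sqrt (1 / 4 * onorm (\<lambda>x. cadjoint T (T x) + T (cadjoint T x)) + \<alpha>)
            \<le> numerical_radius T
          \<and> numerical_radius T
            \<le> sqrt (1 / 4 * onorm (\<lambda>x. cadjoint T (T x) + T (cadjoint T x)) + \<beta>))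
         \<and> (sqrt (1 / 4 * onorm (\<lambda>x. cadjoint T (T x) + T (cadjoint T x)) + \<gamma>)
            \<le> numerical_radius T
          \<and> numerical_radius T
            \<le> sqrt (1 / 4 * onorm (\<lambda>x. cadjoint T (T x) + T (cadjoint T x)) + \<delta>))"
proof -
  define A where "A = re_op T"
  define B where "B = im_op T"
  define P where "P = (\<lambda>x. cadjoint T (T x) + T (cadjoint T x))"
  \<comment> \<open>\<open>C\<close> and \<open>D\<close> stay unscaled to match \<gamma> and
    \<delta>; the factors 2 in \<open>CD_AB\<close>, \<open>quadCD\<close> and \<open>CD_le\<close>
    replace the division by sqrt 2.\<close>
  define C where "C = (\<lambda>x. A x + B x)"
  define D where "D = (\<lambda>x. A x - B x)"
  define w where "w = numerical_radius T"
  have lin: "bounded_linear T" using T by (simp add: bounded_clinear_def)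
  have linA: "bounded_linear A" and linB: "bounded_linear B"
    using T by (simp_all add: A_def B_def bounded_linear_re_op bounded_linear_im_op)
  have linC: "bounded_linear C" and linD: "bounded_linear D"
    unfolding C_def D_def by (intro bounded_linear_add bounded_linear_sub linA linB)+
  have linP: "bounded_linear P"
    unfolding P_def
    by (intro bounded_linear_add bounded_linear_compose[OF lin]
        bounded_linear_compose[OF bounded_linear_cadjoint[OF T]] bounded_linear_cadjoint T lin)
  have symA: "rinner (A x) y = rinner (A y) x" and symB: "rinner (B x) y = rinner (B y) x" for x y
    by (simp_all add: A_def B_def rinner_re_op[OF T] rinner_im_op[OF T])
  have symC: "rinner (C x) y = rinner (C y) x" and symD: "rinner (D x) y = rinner (D y) x" for x y
    using symA[of x y] symB[of x y] by (simp_all add: C_def D_def rinner_simps)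
  have rinner_P: "rinner (P x) y = rinner (T x) (T y) + rinner (cadjoint T x) (cadjoint T y)" for x y
    using rinner_cadjoint[OF T, of y "T x"] rinner_cadjoint[OF T, of "cadjoint T x" y]
    by (simp add: P_def rinner_add_left rinner_add_right rinner_commute)
  have symP: "rinner (P x) y = rinner (P y) x" for x y
    unfolding rinner_P by (simp add: rinner_commute)
  have quadP: "rinner (P x) x = 2 * ((norm (A x))\<^sup>2 + (norm (B x))\<^sup>2)" for x
    using norm_re_op_im_op[of T x] by (simp add: rinner_P rinner_self A_def B_def)
  have CD_AB: "(norm (C x))\<^sup>2 + (norm (D x))\<^sup>2 = 2 * ((norm (A x))\<^sup>2 + (norm (B x))\<^sup>2)" for x
    using parallelogram_law[of "A x" "B x"] by (simp add: C_def D_def)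
  have quadT: "(cmod (cinner (T x) x))\<^sup>2 = (rinner (A x) x)\<^sup>2 + (rinner (B x) x)\<^sup>2" for x
    by (simp add: A_def B_def rinner_re_op[OF T] rinner_im_op[OF T] cmod_power2)
  have quadCD: "(rinner (C x) x)\<^sup>2 + (rinner (D x) x)\<^sup>2 = 2 * (cmod (cinner (T x) x))\<^sup>2" for x
    unfolding quadT by (simp add: C_def D_def rinner_simps power2_sum power2_diff)

  have w0: "0 \<le> w" unfolding w_def by (rule numerical_radius_nonneg[OF lin])
  \<comment> \<open>Used with \<open>k = 1\<close> for \<open>A\<close>, \<open>B\<close> and
    \<open>k = 2\<close> for \<open>C\<close>, \<open>D\<close>: each form squared is one of two
    squares whose sum is given by \<open>quadT\<close> or \<open>quadCD\<close>.\<close>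
  have onorm_le: "(onorm F)\<^sup>2 \<le> k * w\<^sup>2"
    if F: "bounded_linear F" "\<And>x y. rinner (F x) y = rinner (F y) x"
      and q: "\<And>x. (rinner (F x) x)\<^sup>2 \<le> k * (cmod (cinner (T x) x))\<^sup>2" and k: "0 \<le> k" for F k
  proof -
    have "onorm F \<le> sqrt k * w"
    proof (rule onorm_symmetric_le[OF F])
      fix x
      have "\<bar>rinner (F x) x\<bar> \<le> sqrt k * cmod (cinner (T x) x)"
        by (rule power2_le_imp_le) (use q k in \<open>simp_all add: power_mult_distrib\<close>)
      also have "\<dots> \<le> sqrt k * (w * (norm x)\<^sup>2)"
        unfolding w_def by (intro mult_left_mono cmod_cinner_le_numerical_radius lin) (simp add: k)
      finally show "\<bar>rinner (F x) x\<bar> \<le> sqrt k * w * (norm x)\<^sup>2" by simp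
    qed (use k w0 in simp)
    then show ?thesis
      using power_mono[of "onorm F" "sqrt k * w" 2] onorm_pos_le[OF F(1)] k
      by (simp add: power_mult_distrib)
  qed
  have AB_le: "(onorm A)\<^sup>2 \<le> w\<^sup>2" "(onorm B)\<^sup>2 \<le> w\<^sup>2"
    using onorm_le[OF linA symA, of 1] onorm_le[OF linB symB, of 1] by (simp_all add: quadT)
  have CD_le: "(onorm C)\<^sup>2 \<le> 2 * w\<^sup>2" "(onorm D)\<^sup>2 \<le> 2 * w\<^sup>2"
    by (rule onorm_le[OF linC symC] onorm_le[OF linD symD]; simp add: quadCD[symmetric])+

  have P0: "0 \<le> onorm P" by (rule onorm_pos_le[OF linP])
  \<comment> \<open>By \<open>quadP\<close> the form of \<open>P\<close> is a sum of squared norms,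
    so pointwise bounds for \<open>A x\<close> and \<open>B x\<close> control the norm of
    \<open>P\<close>.\<close>
  have P_AB: "onorm P \<le> 2 * ((onorm A)\<^sup>2 + (onorm B)\<^sup>2)"
  proof (rule onorm_symmetric_le[OF linP symP])
    show "\<bar>rinner (P x) x\<bar> \<le> 2 * ((onorm A)\<^sup>2 + (onorm B)\<^sup>2) * (norm x)\<^sup>2" for x
      using norm_apply_sq_le[OF linA, of x] norm_apply_sq_le[OF linB, of x]
      by (simp add: quadP distrib_right)
  qed simp
  have P_CD: "onorm P \<le> (onorm C)\<^sup>2 + (onorm D)\<^sup>2"
  proof (rule onorm_symmetric_le[OF linP symP])
    show "\<bar>rinner (P x) x\<bar> \<le> ((onorm C)\<^sup>2 + (onorm D)\<^sup>2) * (norm x)\<^sup>2" for x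
      using norm_apply_sq_le[OF linC, of x] norm_apply_sq_le[OF linD, of x] CD_AB[of x]
      by (simp add: quadP distrib_right)
  qed simp
  \<comment> \<open>On a unit vector the form of \<open>A\<close> or \<open>B\<close> is at most the
    norm of the image, and the squared norms add up to half the form of \<open>P\<close>.\<close>
  have T_P: "2 * (cmod (cinner (T x) x))\<^sup>2 \<le> onorm P" if x: "norm x = 1" for x
  proof -
    have sq: "(rinner (F x) x)\<^sup>2 \<le> (norm (F x))\<^sup>2" for F :: "'a \<Rightarrow> 'a"
    proof -
      have "\<bar>rinner (F x) x\<bar> \<le> norm (F x)"
        using abs_rinner_le[of "F x" x] x by simp
      then show ?thesis using power_mono[of "\<bar>rinner (F x) x\<bar>" _ 2] by simp
    qed
    have "2 * (cmod (cinner (T x) x))\<^sup>2 \<le> rinner (P x) x"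
      using sq[of A] sq[of B] by (simp add: quadT quadP)
    also have "\<dots> \<le> norm (P x)" using rinner_le_norm[of "P x" x] x by simp
    also have "\<dots> \<le> onorm P" using onorm[OF linP, of x] x by simp
    finally show ?thesis .
  qed
  have T_AB: "(cmod (cinner (T x) x))\<^sup>2 \<le> (onorm A)\<^sup>2 + (onorm B)\<^sup>2" if "norm x = 1" for x
    using rinner_apply_sq_le[OF linA, of x] rinner_apply_sq_le[OF linB, of x] that
    by (simp add: quadT)
  have T_CD: "2 * (cmod (cinner (T x) x))\<^sup>2 \<le> (onorm C)\<^sup>2 + (onorm D)\<^sup>2" if "norm x = 1" for x
    using rinner_apply_sq_le[OF linC, of x] rinner_apply_sq_le[OF linD, of x] that
    by (simp add: quadCD[symmetric])

  have \<alpha>': "\<alpha> = 1 / 2 * \<bar>(onorm A)\<^sup>2 - (onorm B)\<^sup>2\<bar>"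
    and \<beta>': "\<beta> = 1 / 2 * ((onorm A)\<^sup>2 + (onorm B)\<^sup>2)"
    and \<gamma>': "\<gamma> = 1 / 4 * \<bar>(onorm C)\<^sup>2 - (onorm D)\<^sup>2\<bar>"
    and \<delta>': "\<delta> = 1 / 4 * ((onorm C)\<^sup>2 + (onorm D)\<^sup>2)"
    using \<alpha> \<beta> \<gamma> \<delta> by (simp_all add: A_def B_def C_def D_def)
  \<comment> \<open>With \<open>P_AB\<close> the left side is at most the larger of the squared
    norms of \<open>A\<close> and \<open>B\<close>. For \<gamma>, \<open>P_CD\<close> gives half the
    larger one of \<open>C\<close> and \<open>D\<close>, which offsets the 2 in
    \<open>CD_le\<close>.\<close>
  have "1 / 4 * onorm P + \<alpha> \<le> w\<^sup>2" using AB_le P_AB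
    by (simp add: \<alpha>' abs_if field_simps)
  moreover have "1 / 4 * onorm P + \<gamma> \<le> w\<^sup>2" using CD_le P_CD
    by (simp add: \<gamma>' abs_if field_simps)
  ultimately have lower: "sqrt (1 / 4 * onorm P + \<alpha>) \<le> w" "sqrt (1 / 4 * onorm P + \<gamma>) \<le> w"
    using w0 by (simp_all add: real_le_lsqrt)
  have upper: "w \<le> sqrt (1 / 4 * onorm P + \<beta>)" "w \<le> sqrt (1 / 4 * onorm P + \<delta>)"
    unfolding w_def
  proof (rule_tac [!] numerical_radius_le_sqrt)
    show "0 \<le> 1 / 4 * onorm P + \<beta>" "0 \<le> 1 / 4 * onorm P + \<delta>"
      using P0 by (simp_all add: \<beta>' \<delta>')
    \<comment> \<open>Each summand on the right dominates half of the left side; the same split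
      works for \<delta>.\<close>
    show "(cmod (cinner (T x) x))\<^sup>2 \<le> 1 / 4 * onorm P + \<beta>" if "norm x = 1" for x
      using T_P[OF that] T_AB[OF that] by (simp add: \<beta>' field_simps)
    show "(cmod (cinner (T x) x))\<^sup>2 \<le> 1 / 4 * onorm P + \<delta>" if "norm x = 1" for x
      using T_P[OF that] T_CD[OF that] by (simp add: \<delta>' field_simps)
  qed
  show ?thesis
    using lower upper unfolding P_def w_def by blast
qed

end
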